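(* Let $X$ be a weakly Oka complex manifold, let $S$ be a Stein manifold, and let $R$ be an open subset of $S$ that is Stein. Let $U$ and $V$ be open subsets of $R$ with $\overline U\subset V$ and $\overline V\subset R$, where closures are taken in $S$. Then every continuous map $h:S\to X$ that is holomorphic on $R$ can be deformed, through continuous maps $S\to X$ that are holomorphic on $U$, to a holomorphic map $S\to X$; that is, there is a continuous map $H:S\times[0,1]\to X$ such that $H(\cdot,0)=h$, $H(\cdot,t)$ is holomorphic on $U$ for all $t\in[0,1]$, and $H(\cdot,1)$ is holomorphic on $S$.
   Context: Complex manifolds are second countable but not necessarily connected. For complex manifolds $T$ and $X$, $\mathcal O(T,X)$ and $\mathcal C(T,X)$ denote the spaces of holomorphic maps and of continuous maps $T\to X$, respectively, with the compact-open topology. A complex manifold $X$ is weakly Oka (i.e. satisfies the parametric Oka property) if for every Stein manifold $T$ the inclusion $\mathcal O(T,X)\hookrightarrow\mathcal C(T,X)$ is a weak homotopy equivalence. *)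

theory Defs
  imports "HOL-Analysis.Analysis"
begin

section \<open>Holomorphic functions of several complex variables\<close>

text \<open>The dimension is a value rather than a type, because the definition of a weakly Oka manifold
  quantifies over manifolds of all dimensions. The space \<open>\<complex>\<^sup>n\<close> is modelled, in analogy with
  \<^const>\<open>Euclidean_space\<close>, by sequences vanishing from index \<open>n\<close> on.\<close>

definition complex_space :: "nat \<Rightarrow> (nat \<Rightarrow> complex) topology" where
  "complex_space n =
     subtopology (product_topology (\<lambda>_. euclidean) UNIV) {z. \<forall>i\<ge>n. z i = 0}"

text \<open>Complex (Frechet) differentiability at every point of an open subset \<open>W\<close> of \<open>\<complex>\<^sup>n\<close>; the vector
  \<open>a\<close> consists of the partial derivatives at \<open>p\<close>.\<close>

definition holomorphic_on_space ::
    "nat \<Rightarrow> (nat \<Rightarrow> complex) set \<Rightarrow> ((nat \<Rightarrow> complex) \<Rightarrow> complex) \<Rightarrow> bool" where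
  "holomorphic_on_space n W f \<longleftrightarrow>
     (\<forall>p\<in>W. \<exists>a. \<forall>e>0. \<exists>d>0. \<forall>q\<in>W. (\<Sum>i<n. norm (q i - p i)) < d \<longrightarrow>
        norm (f q - f p - (\<Sum>i<n. a i * (q i - p i))) \<le> e * (\<Sum>i<n. norm (q i - p i)))"


section \<open>Complex manifolds\<close>

text \<open>A chart \<open>(n, D, \<phi>)\<close> has domain \<open>D\<close> and takes values in \<open>\<complex>\<^sup>n\<close>. The atlas need not be maximal,
  and different connected components may have different dimensions.\<close>

type_synonym 'a chart = "nat \<times> 'a set \<times> ('a \<Rightarrow> nat \<Rightarrow> complex)"

record 'a mfd =
  mtop :: "'a topology"
  atlas :: "'a chart set"

definition is_chart :: "'a topology \<Rightarrow> 'a chart \<Rightarrow> bool" where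
  "is_chart X = (\<lambda>(n, D, \<phi>).
     openin X D \<and> openin (complex_space n) (\<phi> ` D) \<and>
     homeomorphic_map (subtopology X D) (subtopology (complex_space n) (\<phi> ` D)) \<phi>)"

definition holomorphic_transition :: "'a chart \<Rightarrow> 'a chart \<Rightarrow> bool" where
  "holomorphic_transition = (\<lambda>(n, D, \<phi>) (m, E, \<psi>).
     \<forall>i<m. holomorphic_on_space n (\<phi> ` (D \<inter> E)) (\<lambda>z. \<psi> (inv_into D \<phi> z) i))"

definition complex_manifold :: "'a mfd \<Rightarrow> bool" where
  "complex_manifold M \<longleftrightarrow>
     Hausdorff_space (mtop M) \<and> second_countable (mtop M) \<and>
     (\<forall>c\<in>atlas M. is_chart (mtop M) c) \<and>
     (\<Union>(n, D, \<phi>)\<in>atlas M. D) = topspace (mtop M) \<and>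
     (\<forall>c\<in>atlas M. \<forall>c'\<in>atlas M. holomorphic_transition c c')"

definition open_submanifold :: "'a mfd \<Rightarrow> 'a set \<Rightarrow> 'a mfd" where
  "open_submanifold M R =
     \<lparr>mtop = subtopology (mtop M) R, atlas = (\<lambda>(n, D, \<phi>). (n, D \<inter> R, \<phi>)) ` atlas M\<rparr>"

definition holomorphic_map :: "'a mfd \<Rightarrow> 'b mfd \<Rightarrow> ('a \<Rightarrow> 'b) \<Rightarrow> bool" where
  "holomorphic_map M N f \<longleftrightarrow>
     continuous_map (mtop M) (mtop N) f \<and>
     (\<forall>(n, D, \<phi>)\<in>atlas M. \<forall>(m, E, \<psi>)\<in>atlas N. \<forall>i<m.
        holomorphic_on_space n (\<phi> ` {x\<in>D. f x \<in> E}) (\<lambda>z. \<psi> (f (inv_into D \<phi> z)) i))"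

definition holomorphic_function :: "'a mfd \<Rightarrow> ('a \<Rightarrow> complex) \<Rightarrow> bool" where
  "holomorphic_function M f \<longleftrightarrow>
     (\<forall>(n, D, \<phi>)\<in>atlas M. holomorphic_on_space n (\<phi> ` D) (\<lambda>z. f (inv_into D \<phi> z)))"


section \<open>Stein manifolds\<close>

text \<open>For nonempty compact \<open>K\<close> the bound says \<open>\<bar>f x\<bar> \<le> max\<^sub>K \<bar>f\<bar>\<close>; the hull of the empty set is empty.\<close>

definition holomorphic_hull :: "'a mfd \<Rightarrow> 'a set \<Rightarrow> 'a set" where
  "holomorphic_hull M K =
     {x \<in> topspace (mtop M). \<forall>f. holomorphic_function M f \<longrightarrow> (\<exists>k\<in>K. norm (f x) \<le> norm (f k))}"

definition stein_manifold :: "'a mfd \<Rightarrow> bool" where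
  "stein_manifold M \<longleftrightarrow>
     complex_manifold M \<and>
     (\<forall>K. compactin (mtop M) K \<longrightarrow> compactin (mtop M) (holomorphic_hull M K)) \<and>
     (\<forall>x\<in>topspace (mtop M). \<forall>y\<in>topspace (mtop M). x \<noteq> y \<longrightarrow>
        (\<exists>f. holomorphic_function M f \<and> f x \<noteq> f y))"


section \<open>Mapping spaces\<close>

text \<open>Maps are normalised to be \<^const>\<open>undefined\<close> off the source, so that distinct elements
  represent distinct maps. Taking \<open>K\<close> empty in the subbasis shows that all maps belong to the
  underlying set.\<close>

definition continuous_maps :: "'a topology \<Rightarrow> 'b topology \<Rightarrow> ('a \<Rightarrow> 'b) set" where
  "continuous_maps X Y = {f \<in> extensional (topspace X). continuous_map X Y f}"

definition compact_open_topology :: "'a topology \<Rightarrow> 'b topology \<Rightarrow> ('a \<Rightarrow> 'b) topology" where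
  "compact_open_topology X Y = topology_generated_by
     {{f \<in> continuous_maps X Y. f ` K \<subseteq> W} | K W. compactin X K \<and> openin Y W}"

definition holomorphic_mapping_space :: "'a mfd \<Rightarrow> 'b mfd \<Rightarrow> ('a \<Rightarrow> 'b) topology" where
  "holomorphic_mapping_space T X =
     subtopology (compact_open_topology (mtop T) (mtop X)) {f. holomorphic_map T X f}"


section \<open>Weak homotopy equivalences\<close>

definition cube :: "nat \<Rightarrow> (nat \<Rightarrow> real) topology" where
  "cube n = product_topology (\<lambda>_. top_of_set {0..1}) {..<n}"

definition cube_boundary :: "nat \<Rightarrow> (nat \<Rightarrow> real) set" where
  "cube_boundary n = {x \<in> topspace (cube n). \<exists>i<n. x i = 0 \<or> x i = 1}"

definition spheroids :: "nat \<Rightarrow> 'a topology \<Rightarrow> 'a \<Rightarrow> ((nat \<Rightarrow> real) \<Rightarrow> 'a) set" where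
  "spheroids n X a = {\<sigma>. continuous_map (cube n) X \<sigma> \<and> \<sigma> ` cube_boundary n \<subseteq> {a}}"

definition spheroid_homotopy ::
    "nat \<Rightarrow> 'a topology \<Rightarrow> 'a \<Rightarrow> (((nat \<Rightarrow> real) \<Rightarrow> 'a) \<times> ((nat \<Rightarrow> real) \<Rightarrow> 'a)) set" where
  "spheroid_homotopy n X a =
     {(\<sigma>, \<tau>). homotopic_with (\<lambda>\<rho>. \<rho> ` cube_boundary n \<subseteq> {a}) (cube n) X \<sigma> \<tau>}"

text \<open>The underlying set of the homotopy group \<open>\<pi>\<^sub>n(X, a)\<close>.\<close>

definition homotopy_classes ::
    "nat \<Rightarrow> 'a topology \<Rightarrow> 'a \<Rightarrow> ((nat \<Rightarrow> real) \<Rightarrow> 'a) set set" where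
  "homotopy_classes n X a = spheroids n X a // spheroid_homotopy n X a"

definition induced_on_homotopy_classes ::
    "nat \<Rightarrow> 'b topology \<Rightarrow> ('a \<Rightarrow> 'b) \<Rightarrow> 'a
       \<Rightarrow> ((nat \<Rightarrow> real) \<Rightarrow> 'a) set \<Rightarrow> ((nat \<Rightarrow> real) \<Rightarrow> 'b) set" where
  "induced_on_homotopy_classes n Y f a c = spheroid_homotopy n Y (f a) `` ((\<lambda>\<sigma>. f \<circ> \<sigma>) ` c)"

definition induced_on_path_components ::
    "'b topology \<Rightarrow> ('a \<Rightarrow> 'b) \<Rightarrow> 'a set \<Rightarrow> 'b set" where
  "induced_on_path_components Y f c = (\<Union>x\<in>c. path_component_of_set Y (f x))"

text \<open>For \<open>n \<ge> 1\<close> the induced map on \<open>\<pi>\<^sub>n\<close> is always a group homomorphism, so it is an isomorphism as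
  soon as it is bijective. Path components are treated separately so that the condition on them is
  also meaningful when \<open>X\<close> is empty and has no base points.\<close>

definition weak_homotopy_equivalence :: "'a topology \<Rightarrow> 'b topology \<Rightarrow> ('a \<Rightarrow> 'b) \<Rightarrow> bool" where
  "weak_homotopy_equivalence X Y f \<longleftrightarrow>
     continuous_map X Y f \<and>
     bij_betw (induced_on_path_components Y f) (path_components_of X) (path_components_of Y) \<and>
     (\<forall>n\<ge>1. \<forall>a\<in>topspace X.
        bij_betw (induced_on_homotopy_classes n Y f a)
          (homotopy_classes n X a) (homotopy_classes n Y (f a)))"


section \<open>Weakly Oka manifolds\<close>

text \<open>A second countable \<open>T\<^sub>0\<close> space has at most as many points as there are sets of natural numbers.
  Hence every complex manifold is isomorphic to one whose points have type \<open>nat set\<close>, and it loses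
  no generality to let the Stein manifolds \<open>T\<close> below range over that type.\<close>

lemma complex_manifold_inj_into_nat_set:
  fixes M :: "'a mfd"
  assumes "complex_manifold M"
  shows "\<exists>f :: 'a \<Rightarrow> nat set. inj_on f (topspace (mtop M))"
proof -
  obtain B where B: "countable B" "\<And>V. V \<in> B \<Longrightarrow> openin (mtop M) V"
    "\<And>U x. openin (mtop M) U \<Longrightarrow> x \<in> U \<Longrightarrow> \<exists>V\<in>B. x \<in> V \<and> V \<subseteq> U"
    using assms unfolding complex_manifold_def second_countable_def by metis
  have "inj_on (\<lambda>x. to_nat_on B ` {V\<in>B. x \<in> V}) (topspace (mtop M))"
  proof (rule inj_onI, rule ccontr)
    fix x y
    assume xy: "x \<in> topspace (mtop M)" "y \<in> topspace (mtop M)" "x \<noteq> y"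
      and eq: "to_nat_on B ` {V\<in>B. x \<in> V} = to_nat_on B ` {V\<in>B. y \<in> V}"
    obtain U where U: "openin (mtop M) U" "x \<in> U" "y \<notin> U"
      using assms xy unfolding complex_manifold_def Hausdorff_space_def disjnt_def by blast
    then obtain V where V: "V \<in> B" "x \<in> V" "y \<notin> V"
      using B(3) by blast
    then have "to_nat_on B V \<in> to_nat_on B ` {V\<in>B. y \<in> V}"
      using eq by blast
    then show False
      using V \<open>countable B\<close> by (auto simp: to_nat_on_inj)
  qed
  then show ?thesis by blast
qed

definition weakly_oka :: "'a mfd \<Rightarrow> bool" where
  "weakly_oka X \<longleftrightarrow>
     complex_manifold X \<and>
     (\<forall>T :: nat set mfd. stein_manifold T \<longrightarrow>
        weak_homotopy_equivalence (holomorphic_mapping_space T X)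
          (compact_open_topology (mtop T) (mtop X)) (\<lambda>f. f))"

end

theory Submission
  imports Defs
begin

text \<open>Since \<open>X\<close> is weakly Oka and \<open>S\<close> is Stein, there is a homotopy \<open>P\<close> from \<open>h\<close> to a holomorphic map
  \<open>S \<rightarrow> X\<close>. Its restriction to \<open>R\<close> is a path in \<open>\<C>(R, X)\<close> with end points in \<open>\<O>(R, X)\<close>, so as
  \<open>R\<close> is Stein it can be deformed, with fixed end points, to a path in \<open>\<O>(R, X)\<close>. A Urysohn
  function that is \<open>1\<close> on \<open>U\<close> and \<open>0\<close> off \<open>V\<close>, used as the parameter of this deformation, glues the
  deformed path near \<open>U\<close> to \<open>P\<close> off \<open>V\<close>.\<close>

section \<open>The exponential law for the compact-open topology\<close>

text \<open>For nonconstant \<open>\<rho>\<close> the map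
  \<open>x \<mapsto> G (x, t, \<rho> x)\<close> has no reason to be holomorphic. The cut-off
  therefore varies only where the deformation promises no holomorphy, outside \<open>U\<close> and
  inside \<open>V\<close>. At the two ends of the time interval such freedom would be fatal, since
  \<open>h\<close> must be recovered at time 0 and a map holomorphic on all of \<open>S\<close>
  reached at time 1. This is why the deformation over \<open>R\<close> must fix end points: at
  \<open>t = 0\<close> and \<open>t = 1\<close> the value of \<open>G\<close> does not depend on its
  last argument, so the choice of \<open>\<rho>\<close> is invisible there.

  A deformation with fixed end points comes from two properties of the inclusion of mapping spaces
  over \<open>R\<close>. Injectivity on path components closes the path to a loop by a path of
  holomorphic maps, and surjectivity on the fundamental group deforms this loop.

  Two translations are needed. Paths of maps must become maps on products, by the exponential law
  for locally compact Hausdorff sources. And \<open>weakly_oka\<close> tests manifolds with points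
  in \<open>nat set\<close>, so \<open>S\<close> and \<open>R\<close> are carried to that type along
  an injection.\<close>

lemma topspace_compact_open_topology [simp]:
  "topspace (compact_open_topology X Y) = continuous_maps X Y"
proof -
  have "continuous_maps X Y \<in> {{f \<in> continuous_maps X Y. f ` K \<subseteq> W} | K W. compactin X K \<and> openin Y W}"
    by (rule CollectI, rule exI[of _ "{}"], rule exI[of _ "{}"]) auto
  then show ?thesis
    unfolding compact_open_topology_def topology_generated_by_topspace by blast
qed

lemma openin_compact_open_topology_subbasis:
  assumes "compactin X K" "openin Y W"
  shows "openin (compact_open_topology X Y) {f \<in> continuous_maps X Y. f ` K \<subseteq> W}"
  unfolding compact_open_topology_def
  by (rule topology_generated_by_Basis) (use assms in blast)

text \<open>It suffices to treat the subbasic sets. For compact \<open>K\<close>, the tube lemma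
  thickens \<open>K \<times> {z}\<close> inside the open preimage of \<open>W\<close> to a product
  of open sets. The maps are restricted because points of the mapping space are extensional.\<close>

lemma continuous_map_curry_compact_open:
  assumes F: "continuous_map (prod_topology T Z) Y F"
  shows "continuous_map Z (compact_open_topology T Y) (\<lambda>z. \<lambda>x\<in>topspace T. F (x, z))"
proof -
  have slice: "continuous_map T Y (\<lambda>x\<in>topspace T. F (x, z))" if "z \<in> topspace Z" for z
  proof -
    have "continuous_map T (prod_topology T Z) (\<lambda>x. (x, z))"
      using that by (simp add: continuous_map_pairwise o_def)
    from continuous_map_compose[OF this F] show ?thesis
      by (rule continuous_map_eq) simp
  qed
  have "openin Z ((\<lambda>z. \<lambda>x\<in>topspace T. F (x, z)) -` {f \<in> continuous_maps T Y. f ` K \<subseteq> W} \<inter> topspace Z)"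
    (is "openin Z ?P") if K: "compactin T K" and W: "openin Y W" for K W
  proof (subst openin_subopen, intro strip)
    fix z assume z: "z \<in> ?P"
    have KT: "K \<subseteq> topspace T"
      using K by (rule compactin_subset_topspace)
    have sub: "K \<times> {z} \<subseteq> {u \<in> topspace (prod_topology T Z). F u \<in> W}"
    proof clarify
      fix x assume "x \<in> K"
      then have "x \<in> topspace T" and "(\<lambda>x\<in>topspace T. F (x, z)) x \<in> W"
        using z KT by blast+
      then show "(x, z) \<in> topspace (prod_topology T Z) \<and> F (x, z) \<in> W"
        using z by simp
    qed
    have ope: "openin (prod_topology T Z) {u \<in> topspace (prod_topology T Z). F u \<in> W}"
      using F W by (rule openin_continuous_map_preimage)
    have zZ: "z \<in> topspace Z"
      using z by (rule IntD2)
    obtain A B where AB: "openin T A" "openin Z B" "K \<subseteq> A" "z \<in> B"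
        "A \<times> B \<subseteq> {u \<in> topspace (prod_topology T Z). F u \<in> W}"
      using tube_lemma_left[OF ope K zZ sub] by (elim exE conjE)
    have "B \<subseteq> ?P"
    proof
      fix z' assume "z' \<in> B"
      then have "z' \<in> topspace Z"
        using AB(2) openin_subset by blast
      then show "z' \<in> ?P"
        using slice AB \<open>z' \<in> B\<close> KT by (auto simp: continuous_maps_def)
    qed
    then show "\<exists>B. openin Z B \<and> z \<in> B \<and> B \<subseteq> ?P"
      using AB by blast
  qed
  moreover have "(\<lambda>z. \<lambda>x\<in>topspace T. F (x, z)) ` topspace Z
      \<subseteq> topspace (compact_open_topology T Y)"
    using slice by (auto simp: continuous_maps_def)
  ultimately show ?thesis
    unfolding compact_open_topology_def topology_generated_by_topspace
    by (intro continuous_on_generated_topo) auto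
qed

text \<open>Local compactness provides a compact neighbourhood \<open>K\<close> of \<open>x\<close>
  that \<open>g z\<close> still maps into \<open>W\<close>. The maps sending \<open>K\<close> into
  \<open>W\<close> form a subbasic open set, so a whole product neighbourhood of
  \<open>(x, z)\<close> goes into \<open>W\<close>.\<close>

lemma continuous_map_uncurry_compact_open:
  assumes T: "locally_compact_space T" "Hausdorff_space T"
    and g: "continuous_map Z (compact_open_topology T Y) g"
  shows "continuous_map (prod_topology T Z) Y (\<lambda>(x, z). g z x)"
proof -
  have gz: "continuous_map T Y (g z)" if "z \<in> topspace Z" for z
    using continuous_map_image_subset_topspace[OF g] that by (auto simp: continuous_maps_def)
  have "openin (prod_topology T Z) {u \<in> topspace (prod_topology T Z). (\<lambda>(x, z). g z x) u \<in> W}"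
    (is "openin _ ?P") if W: "openin Y W" for W
  proof (subst openin_subopen, intro strip)
    fix u assume u: "u \<in> ?P"
    obtain x z where xz: "u = (x, z)" by (cases u)
    have x: "x \<in> topspace T" and z: "z \<in> topspace Z" and gzx: "g z x \<in> W"
      using u xz by auto
    have "openin T {x \<in> topspace T. g z x \<in> W}"
      using gz[OF z] W by (rule openin_continuous_map_preimage)
    moreover have "neighbourhood_base_of (compactin T) T"
      using T locally_compact_space_neighbourhood_base by blast
    ultimately obtain A K where AK: "openin T A" "compactin T K" "x \<in> A" "A \<subseteq> K"
        "K \<subseteq> {x \<in> topspace T. g z x \<in> W}"
      using x gzx unfolding neighbourhood_base_of by (metis (mono_tags, lifting) mem_Collect_eq)
    define B where "B = {z \<in> topspace Z. g z \<in> {f \<in> continuous_maps T Y. f ` K \<subseteq> W}}"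
    have "openin Z B"
      unfolding B_def using g openin_compact_open_topology_subbasis[OF AK(2) W]
      by (rule openin_continuous_map_preimage)
    moreover have "z \<in> B"
      using z AK(5) continuous_map_image_subset_topspace[OF g] by (auto simp: B_def)
    moreover have "A \<times> B \<subseteq> ?P"
      using AK openin_subset[OF AK(1)] by (fastforce simp: B_def image_subset_iff)
    ultimately show "\<exists>Q. openin (prod_topology T Z) Q \<and> u \<in> Q \<and> Q \<subseteq> ?P"
      using AK(1,3) xz by (intro exI[of _ "A \<times> B"]) (auto simp: openin_prod_Times_iff)
  qed
  moreover have "(\<lambda>(x, z). g z x) \<in> topspace (prod_topology T Z) \<rightarrow> topspace Y"
    using continuous_map_image_subset_topspace[OF gz] by auto
  ultimately show ?thesis
    unfolding continuous_map_def by blast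
qed

section \<open>Inclusions that are weak homotopy equivalences\<close>

lemma path_component_of_inclusion:
  "path_component_of (subtopology Y A) x y \<Longrightarrow> path_component_of Y x y"
  unfolding path_component_of_def pathin_subtopology by blast

text \<open>This is surjectivity on path components, made concrete for an inclusion.\<close>

lemma weak_homotopy_equivalence_inclusion_path_into:
  assumes whe: "weak_homotopy_equivalence (subtopology Y A) Y (\<lambda>y. y)"
    and y: "y \<in> topspace Y"
  obtains a where "a \<in> A" "path_component_of Y y a"
proof -
  have "path_component_of_set Y y \<in> path_components_of Y"
    using y by (auto simp: path_components_of_def)
  moreover have "induced_on_path_components Y (\<lambda>y. y) ` path_components_of (subtopology Y A)
      = path_components_of Y"
    using whe unfolding weak_homotopy_equivalence_def bij_betw_def by (elim conjE)
  ultimately obtain c where c: "c \<in> path_components_of (subtopology Y A)"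
    "path_component_of_set Y y = induced_on_path_components Y (\<lambda>y. y) c"
    by (auto simp: image_iff)
  moreover have "path_component_of Y y y"
    using y by (simp add: path_component_of_refl)
  ultimately obtain a where "a \<in> c" "path_component_of Y a y"
    unfolding induced_on_path_components_def by auto
  then show thesis
    using that path_components_of_subset[OF c(1)] path_component_of_sym[of Y a y] by auto
qed

text \<open>This is injectivity on path components: the components of \<open>a\<close> and
  \<open>b\<close> in \<open>A\<close> induce the same component of \<open>Y\<close>, hence
  coincide.\<close>

lemma weak_homotopy_equivalence_inclusion_path_lift:
  assumes whe: "weak_homotopy_equivalence (subtopology Y A) Y (\<lambda>y. y)"
    and ab: "a \<in> A" "b \<in> A" and p: "path_component_of Y a b"
  shows "path_component_of (subtopology Y A) a b"
proof -
  have Y: "a \<in> topspace Y" "b \<in> topspace Y"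
    using path_component_in_topspace[OF p] by auto
  let ?c = "path_component_of_set (subtopology Y A)"
  have ind: "induced_on_path_components Y (\<lambda>y. y) (?c x) = path_component_of_set Y x"
    if "x \<in> topspace Y" "x \<in> A" for x
  proof -
    have "x \<in> ?c x"
      using that by (simp add: path_component_of_refl)
    then show ?thesis
      unfolding induced_on_path_components_def
      by (auto dest: path_component_of_inclusion intro: path_component_of_trans)
  qed
  have eq: "path_component_of_set Y a = path_component_of_set Y b"
    using p by (subst (asm) path_component_of_equiv) simp
  have comps: "?c a \<in> path_components_of (subtopology Y A)" "?c b \<in> path_components_of (subtopology Y A)"
    using Y ab by (auto simp: path_components_of_def)
  have inj: "inj_on (induced_on_path_components Y (\<lambda>y. y)) (path_components_of (subtopology Y A))"
    using whe unfolding weak_homotopy_equivalence_def bij_betw_def by (elim conjE)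
  have "?c a = ?c b"
    using inj_onD[OF inj _ comps] ind[OF Y(1) ab(1)] ind[OF Y(2) ab(2)] eq by simp
  moreover have "b \<in> ?c b"
    using Y ab by (simp add: path_component_of_refl)
  ultimately show ?thesis
    by blast
qed

text \<open>This is surjectivity on the \<open>n\<close>-th homotopy group, restated for
  representatives instead of classes.\<close>

lemma weak_homotopy_equivalence_inclusion_spheroid:
  assumes whe: "weak_homotopy_equivalence (subtopology Y A) Y (\<lambda>y. y)" and n: "n \<ge> 1"
    and a: "a \<in> A" "a \<in> topspace Y" and \<gamma>: "\<gamma> \<in> spheroids n Y a"
  obtains \<sigma> where "\<sigma> \<in> spheroids n (subtopology Y A) a" "(\<gamma>, \<sigma>) \<in> spheroid_homotopy n Y a"
proof -
  let ?X = "subtopology Y A"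
  have "spheroid_homotopy n Y a `` {\<gamma>} \<in> homotopy_classes n Y a"
    using \<gamma> unfolding homotopy_classes_def by (rule quotientI)
  moreover have "induced_on_homotopy_classes n Y (\<lambda>y. y) a ` homotopy_classes n ?X a
      = homotopy_classes n Y a"
    using whe n a unfolding weak_homotopy_equivalence_def bij_betw_def by simp
  ultimately obtain c where c: "c \<in> homotopy_classes n ?X a"
    "spheroid_homotopy n Y a `` {\<gamma>} = induced_on_homotopy_classes n Y (\<lambda>y. y) a c"
    by blast
  \<comment> \<open>By reflexivity \<open>\<gamma>\<close> lies in its own class, hence in the class
    induced by \<open>c\<close>; this yields a representative \<open>\<sigma>\<close> of
    \<open>c\<close> homotopic to \<open>\<gamma>\<close>.\<close>
  have "(\<gamma>, \<gamma>) \<in> spheroid_homotopy n Y a"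
    using \<gamma> by (auto simp: spheroid_homotopy_def spheroids_def)
  then obtain \<sigma> where \<sigma>: "\<sigma> \<in> c" "(\<sigma>, \<gamma>) \<in> spheroid_homotopy n Y a"
    using c(2) unfolding induced_on_homotopy_classes_def o_def by auto
  obtain \<rho> where "(\<rho>, \<sigma>) \<in> spheroid_homotopy n ?X a"
    using c(1) \<sigma>(1) unfolding homotopy_classes_def quotient_def by auto
  then have "\<sigma> \<in> spheroids n ?X a"
    unfolding spheroid_homotopy_def spheroids_def
    using homotopic_with_imp_continuous_maps homotopic_with_imp_property by blast
  moreover have "(\<gamma>, \<sigma>) \<in> spheroid_homotopy n Y a"
    using \<sigma>(2) homotopic_with_symD by (auto simp: spheroid_homotopy_def)
  ultimately show thesis
    by (rule that)
qed

abbreviation (input) I01 :: "real topology" where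
  "I01 \<equiv> top_of_set {0..1}"

text \<open>The case \<open>n = 1\<close> of the previous lemma, written on a square: the first
  coordinate of \<open>F\<close> is the homotopy parameter, the second runs along the loop. So the
  left side carries \<open>\<gamma>\<close>, the right side lies in \<open>A\<close>, and bottom and
  top are constant.\<close>

lemma weak_homotopy_equivalence_inclusion_loop:
  fixes \<gamma> :: "real \<Rightarrow> 'a"
  assumes whe: "weak_homotopy_equivalence (subtopology Y A) Y (\<lambda>y. y)"
    and \<gamma>: "pathin Y \<gamma>" "\<gamma> 0 = a" "\<gamma> 1 = a" and a: "a \<in> A"
  obtains F where "continuous_map (prod_topology I01 I01) Y F"
    "\<And>t. t \<in> {0..1} \<Longrightarrow> F (0, t) = \<gamma> t" "\<And>t. t \<in> {0..1} \<Longrightarrow> F (1, t) \<in> A"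
    "\<And>s. s \<in> {0..1} \<Longrightarrow> F (s, 0) = a" "\<And>s. s \<in> {0..1} \<Longrightarrow> F (s, 1) = a"
proof -
  \<comment> \<open>Points of \<open>cube 1\<close> are functions on \<open>{..<1}\<close>;
    \<open>e\<close> identifies the unit interval with this cube, and evaluation at 0 inverts
    it.\<close>
  define e :: "real \<Rightarrow> nat \<Rightarrow> real" where "e = (\<lambda>t. \<lambda>i\<in>{..<1}. t)"
  have e: "continuous_map I01 (cube 1) e"
    unfolding cube_def e_def continuous_map_componentwise by auto
  have e0: "e t 0 = t" for t
    by (simp add: e_def)
  have eb: "e 0 \<in> cube_boundary 1" "e 1 \<in> cube_boundary 1"
    using continuous_map_image_subset_topspace[OF e] by (auto simp: cube_boundary_def e0)
  have "continuous_map (cube 1) I01 (\<lambda>x. x 0)"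
    unfolding cube_def by (rule continuous_map_product_projection) simp
  then have "continuous_map (cube 1) Y (\<gamma> \<circ> (\<lambda>x. x 0))"
    using \<gamma>(1) unfolding pathin_def by (rule continuous_map_compose)
  then have "\<gamma> \<circ> (\<lambda>x. x 0) \<in> spheroids 1 Y a"
    using \<gamma>(2,3) by (auto simp: spheroids_def cube_boundary_def)
  moreover have "a \<in> topspace Y"
    using \<gamma> path_start_in_topspace by blast
  ultimately obtain \<sigma> where \<sigma>: "\<sigma> \<in> spheroids 1 (subtopology Y A) a"
    and "(\<gamma> \<circ> (\<lambda>x. x 0), \<sigma>) \<in> spheroid_homotopy 1 Y a"
    using weak_homotopy_equivalence_inclusion_spheroid[OF whe order_refl a] by blast
  then obtain h where h: "continuous_map (prod_topology I01 (cube 1)) Y h"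
      "\<And>x. h (0, x) = \<gamma> (x 0)" "\<And>x. h (1, x) = \<sigma> x"
      "\<And>s. s \<in> {0..1} \<Longrightarrow> (\<lambda>x. h (s, x)) ` cube_boundary 1 \<subseteq> {a}"
    unfolding spheroid_homotopy_def homotopic_with_def by (auto simp: o_def)
  show thesis
  proof (rule that)
    have "continuous_map (prod_topology I01 I01) (prod_topology I01 (cube 1)) (\<lambda>(s, t). (s, e t))"
      using e unfolding continuous_map_prod_top by simp
    from continuous_map_compose[OF this h(1)]
    show "continuous_map (prod_topology I01 I01) Y (\<lambda>(s, t). h (s, e t))"
      by (simp add: o_def case_prod_unfold)
    show "(\<lambda>(s, t). h (s, e t)) (0, t) = \<gamma> t" for t
      by (simp add: h e0)
    show "(\<lambda>(s, t). h (s, e t)) (1, t) \<in> A" if "t \<in> {0..1}" for t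
    proof -
      have "e t \<in> topspace (cube 1)"
        using continuous_map_image_subset_topspace[OF e] that by auto
      then show ?thesis
        using \<sigma> continuous_map_image_subset_topspace[of "cube 1" "subtopology Y A" \<sigma>]
        by (auto simp: h spheroids_def)
    qed
    show "(\<lambda>(s, t). h (s, e t)) (s, 0) = a" "(\<lambda>(s, t). h (s, e t)) (s, 1) = a"
      if "s \<in> {0..1}" for s
      using h(4)[OF that] eb by auto
  qed
qed

text \<open>Close the path \<open>p\<close> to a loop by a path \<open>q\<close> in \<open>A\<close> and deform that loop into \<open>A\<close> by \<open>F\<close>. Then
  \<open>p\<close> runs along half of one side of the square on which \<open>F\<close> is defined, and \<open>F\<close> maps the rest of
  the boundary into \<open>A\<close>; since the square is convex, \<open>p\<close> can be pushed linearly across it.\<close>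

lemma weak_homotopy_equivalence_inclusion_deform_path:
  fixes p :: "real \<Rightarrow> 'a"
  assumes whe: "weak_homotopy_equivalence (subtopology Y A) Y (\<lambda>y. y)"
    and p: "pathin Y p" "p 0 \<in> A" "p 1 \<in> A"
  obtains G where "continuous_map (prod_topology I01 I01) Y G"
    "\<And>t. t \<in> {0..1} \<Longrightarrow> G (t, 0) = p t" "\<And>t. t \<in> {0..1} \<Longrightarrow> G (t, 1) \<in> A"
    "\<And>s. s \<in> {0..1} \<Longrightarrow> G (0, s) = p 0" "\<And>s. s \<in> {0..1} \<Longrightarrow> G (1, s) = p 1"
proof -
  \<comment> \<open>The closing path must run backwards, from \<open>p 1\<close> to
    \<open>p 0\<close>.\<close>
  have "path_component_of Y (p 1) (p 0)"
    using p(1) path_component_of_sym by (metis path_component_of_def)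
  then have "path_component_of (subtopology Y A) (p 1) (p 0)"
    using weak_homotopy_equivalence_inclusion_path_lift[OF whe] p by blast
  then obtain q where q: "pathin Y q" "\<And>t. t \<in> {0..1} \<Longrightarrow> q t \<in> A" "q 0 = p 1" "q 1 = p 0"
    unfolding path_component_of_def pathin_subtopology by blast
  define \<gamma> where "\<gamma> t = (if t \<le> 1/2 then p (2 * t) else q (2 * t - 1))" for t :: real
  have "pathin Y \<gamma>"
    unfolding pathin_def \<gamma>_def
  proof (rule continuous_map_cases_le)
    have "continuous_map (subtopology I01 {t \<in> topspace I01. t \<le> 1/2}) I01 (\<lambda>t. 2 * t)"
      by (auto simp: subtopology_subtopology continuous_map_in_subtopology intro!: continuous_intros)
    from continuous_map_compose[OF this p(1)[unfolded pathin_def]]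
    show "continuous_map (subtopology I01 {t \<in> topspace I01. t \<le> 1/2}) Y (\<lambda>t. p (2 * t))"
      by (simp add: o_def)
    have "continuous_map (subtopology I01 {t \<in> topspace I01. 1/2 \<le> t}) I01 (\<lambda>t. 2 * t - 1)"
      by (auto simp: subtopology_subtopology continuous_map_in_subtopology intro!: continuous_intros)
    from continuous_map_compose[OF this q(1)[unfolded pathin_def]]
    show "continuous_map (subtopology I01 {t \<in> topspace I01. 1/2 \<le> t}) Y (\<lambda>t. q (2 * t - 1))"
      by (simp add: o_def)
    show "p (2 * t) = q (2 * t - 1)" if "t = 1/2" for t
      using q unfolding that by simp
  qed auto
  moreover have "\<gamma> 0 = p 0" "\<gamma> 1 = p 0"
    using q by (simp_all add: \<gamma>_def)
  ultimately obtain F where F: "continuous_map (prod_topology I01 I01) Y F"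
    "\<And>t. t \<in> {0..1} \<Longrightarrow> F (0, t) = \<gamma> t" "\<And>t. t \<in> {0..1} \<Longrightarrow> F (1, t) \<in> A"
    "\<And>s. s \<in> {0..1} \<Longrightarrow> F (s, 0) = p 0" "\<And>s. s \<in> {0..1} \<Longrightarrow> F (s, 1) = p 0"
    using weak_homotopy_equivalence_inclusion_loop[OF whe _ _ _ p(2)] by metis
  \<comment> \<open>\<open>(\<kappa>\<^sub>1, \<kappa>\<^sub>2)\<close> runs through \<open>(0,0)\<close>, \<open>(1,0)\<close>, \<open>(1,1)\<close>, \<open>(0,1)\<close>, \<open>(0,1/2)\<close>.\<close>
  define \<kappa>\<^sub>1 where "\<kappa>\<^sub>1 t = max 0 (min 1 (min (4 * t) (3 - 4 * t)))" for t :: real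
  define \<kappa>\<^sub>2 where "\<kappa>\<^sub>2 t = max 0 (min (4 * t - 1) (min 1 (5/2 - 2 * t)))" for t :: real
  have \<kappa>: "\<kappa>\<^sub>1 t \<in> {0..1}" "\<kappa>\<^sub>2 t \<in> {0..1}" for t
    by (auto simp: \<kappa>\<^sub>1_def \<kappa>\<^sub>2_def)
  \<comment> \<open>Each of the four legs takes a quarter of the time. The last covers only half a
    side, hence its slope 2 instead of 4. The alternatives are bottom, right side, top, and upper
    half of the left side.\<close>
  have \<kappa>_cases: "\<kappa>\<^sub>2 t = 0 \<or> \<kappa>\<^sub>1 t = 1 \<or> \<kappa>\<^sub>2 t = 1 \<or> \<kappa>\<^sub>1 t = 0 \<and> 1/2 \<le> \<kappa>\<^sub>2 t"
    if "t \<in> {0..1}" for t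
    using that by (auto simp: \<kappa>\<^sub>1_def \<kappa>\<^sub>2_def max_def min_def)
  have \<kappa>A: "F (\<kappa>\<^sub>1 t, \<kappa>\<^sub>2 t) \<in> A" if t: "t \<in> {0..1}" for t
  proof -
    \<comment> \<open>The upper half of the left side carries \<open>q\<close>. At
      \<open>1/2\<close> the definition of \<open>\<gamma>\<close> takes the branch of
      \<open>p\<close>, with value \<open>p 1\<close>, so this point is treated separately.\<close>
    have "F (0, u) \<in> A" if "u \<in> {0..1}" "1/2 \<le> u" for u
    proof (cases "u = 1/2")
      case True
      show ?thesis unfolding True using F(2)[of "1/2"] p by (simp add: \<gamma>_def)
    next
      case False
      then show ?thesis using F(2)[of u] q(2)[of "2 * u - 1"] that by (simp add: \<gamma>_def)
    qed
    then show ?thesis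
      using \<kappa>_cases[OF t] F(3)[OF \<kappa>(2)[of t]] F(4)[OF \<kappa>(1)[of t]] F(5)[OF \<kappa>(1)[of t]] \<kappa>(2)[of t] p(2)
      by metis
  qed
  \<comment> \<open>Linear interpolation from \<open>(0, t / 2)\<close>, along which
    \<open>F\<close> is \<open>p\<close>, to
    \<open>(\<kappa>\<^sub>1 t, \<kappa>\<^sub>2 t)\<close>. Both paths start at
    \<open>(0, 0)\<close> and end at \<open>(0, 1/2)\<close>, so the end points stay fixed.\<close>
  define \<mu>\<^sub>1 where "\<mu>\<^sub>1 = (\<lambda>(t, s). s * \<kappa>\<^sub>1 t)"
  define \<mu>\<^sub>2 where "\<mu>\<^sub>2 = (\<lambda>(t, s). (1 - s) * (t / 2) + s * \<kappa>\<^sub>2 t)"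
  have cont: "continuous_map (prod_topology I01 I01) (prod_topology I01 I01) (\<lambda>u. (\<mu>\<^sub>1 u, \<mu>\<^sub>2 u))"
  proof -
    have eq: "prod_topology I01 I01 = top_of_set ({0..1} \<times> {0..1})"
      by simp
    have "\<mu>\<^sub>1 (t, s) \<in> {0..1}" if "t \<in> {0..1}" "s \<in> {0..1}" for t s
      using that \<kappa>(1)[of t] by (simp add: \<mu>\<^sub>1_def mult_le_one)
    moreover have "\<mu>\<^sub>2 (t, s) \<in> {0..1}" if "t \<in> {0..1}" "s \<in> {0..1}" for t s
      using that \<kappa>(2)[of t] convex_bound_le[of "t / 2" 1 "\<kappa>\<^sub>2 t" "1 - s" s] by (simp add: \<mu>\<^sub>2_def)
    ultimately have "(\<lambda>u. (\<mu>\<^sub>1 u, \<mu>\<^sub>2 u)) \<in> {0..1} \<times> {0..1} \<rightarrow> {0..1} \<times> {0..1}"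
      by auto
    moreover have "continuous_on ({0..1} \<times> {0..1}) (\<lambda>u. (\<mu>\<^sub>1 u, \<mu>\<^sub>2 u))"
      unfolding \<mu>\<^sub>1_def \<mu>\<^sub>2_def \<kappa>\<^sub>1_def \<kappa>\<^sub>2_def case_prod_unfold by (intro continuous_intros) auto
    ultimately show ?thesis
      unfolding eq by simp
  qed
  show thesis
  proof (rule that)
    show "continuous_map (prod_topology I01 I01) Y (\<lambda>u. F (\<mu>\<^sub>1 u, \<mu>\<^sub>2 u))"
      using continuous_map_compose[OF cont F(1)] by (simp add: o_def)
    show "F (\<mu>\<^sub>1 (t, 0), \<mu>\<^sub>2 (t, 0)) = p t" if "t \<in> {0..1}" for t
      using that F(2)[of "t / 2"] by (simp add: \<mu>\<^sub>1_def \<mu>\<^sub>2_def \<gamma>_def)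
    show "F (\<mu>\<^sub>1 (t, 1), \<mu>\<^sub>2 (t, 1)) \<in> A" if "t \<in> {0..1}" for t
      using \<kappa>A[OF that] by (simp add: \<mu>\<^sub>1_def \<mu>\<^sub>2_def)
    show "F (\<mu>\<^sub>1 (0, s), \<mu>\<^sub>2 (0, s)) = p 0" for s
      using F(4)[of 0] by (simp add: \<mu>\<^sub>1_def \<mu>\<^sub>2_def \<kappa>\<^sub>1_def \<kappa>\<^sub>2_def)
    show "F (\<mu>\<^sub>1 (1, s), \<mu>\<^sub>2 (1, s)) = p 1" for s
      using F(2)[of "1/2"] by (simp add: \<mu>\<^sub>1_def \<mu>\<^sub>2_def \<kappa>\<^sub>1_def \<kappa>\<^sub>2_def \<gamma>_def field_simps)
  qed
qed


section \<open>Topology of complex manifolds\<close>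

lemma Hausdorff_space_complex_space: "Hausdorff_space (complex_space n)"
  unfolding complex_space_def
  by (intro Hausdorff_space_subtopology) (simp add: Hausdorff_space_product_topology)

text \<open>As a product this space has \<open>n\<close> factors \<complex>, while all others are
  the point 0. An infinite product of locally compact spaces is locally compact when all but
  finitely many factors are compact.\<close>

lemma locally_compact_complex_space: "locally_compact_space (complex_space n)"
proof -
  let ?S = "\<lambda>i. if i < n then UNIV else {0::complex}"
  have "{z. \<forall>i\<ge>n. z i = 0} = (\<Pi>\<^sub>E i\<in>UNIV. ?S i)"
    by (force simp: PiE_iff split: if_splits)
  then have eq: "complex_space n = product_topology (\<lambda>i. top_of_set (?S i)) UNIV"
    unfolding complex_space_def by (simp add: subtopology_product_topology)
  have "finite {i \<in> UNIV. \<not> compact_space (top_of_set (?S i))}"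
    by (rule finite_subset[of _ "{..<n}"]) (auto simp: compact_space_subtopology split: if_splits)
  moreover have "locally_compact_space (top_of_set (?S i))" for i
    by (auto simp: locally_compact_space_euclidean compact_imp_locally_compact_space
        compact_space_subtopology)
  ultimately show ?thesis
    unfolding eq locally_compact_space_product_topology by blast
qed

lemma chart_domain:
  assumes "complex_manifold M" "(n, D, \<phi>) \<in> atlas M"
  shows "openin (mtop M) D" "D \<subseteq> topspace (mtop M)" "inj_on \<phi> D"
    "openin (complex_space n) (\<phi> ` D)"
    "homeomorphic_map (subtopology (mtop M) D) (subtopology (complex_space n) (\<phi> ` D)) \<phi>"
proof -
  have c: "is_chart (mtop M) (n, D, \<phi>)"
    using assms unfolding complex_manifold_def by blast
  then show D: "openin (mtop M) D" "openin (complex_space n) (\<phi> ` D)"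
    and hom: "homeomorphic_map (subtopology (mtop M) D) (subtopology (complex_space n) (\<phi> ` D)) \<phi>"
    unfolding is_chart_def by auto
  show "D \<subseteq> topspace (mtop M)"
    using D(1) by (rule openin_subset)
  then show "inj_on \<phi> D"
    using homeomorphic_imp_injective_map[OF hom] by (simp add: Int_absorb1)
qed

lemma complex_manifold_locally_compact_space:
  assumes M: "complex_manifold M"
  shows "locally_compact_space (mtop M)"
  unfolding locally_compact_space_def
proof
  fix x assume "x \<in> topspace (mtop M)"
  then obtain n D \<phi> where c: "(n, D, \<phi>) \<in> atlas M" and x: "x \<in> D"
    using M unfolding complex_manifold_def by fast
  note D = chart_domain(1)[OF M c] and im = chart_domain(4)[OF M c] and hom = chart_domain(5)[OF M c]
  have "locally_compact_space (subtopology (complex_space n) (\<phi> ` D))"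
    using im Hausdorff_space_complex_space locally_compact_complex_space
    by (blast intro: locally_compact_space_open_subset)
  moreover have "subtopology (complex_space n) (\<phi> ` D) homeomorphic_space subtopology (mtop M) D"
    using hom homeomorphic_map_imp_homeomorphic_space homeomorphic_space_sym by blast
  ultimately have "locally_compact_space (subtopology (mtop M) D)"
    by (rule homeomorphic_locally_compact_spaceD)
  moreover have "x \<in> topspace (subtopology (mtop M) D)"
    using x openin_subset[OF D] by auto
  ultimately obtain A K where "openin (subtopology (mtop M) D) A" "compactin (subtopology (mtop M) D) K"
      "x \<in> A" "A \<subseteq> K"
    unfolding locally_compact_space_def by blast
  then show "\<exists>A K. openin (mtop M) A \<and> compactin (mtop M) K \<and> x \<in> A \<and> A \<subseteq> K"
    using D by (meson compactin_subtopology openin_trans_full)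
qed

text \<open>This is what Urysohn's lemma asks for. Regularity comes from local compactness and the
  Hausdorff property, the Lindelof property from second countability.\<close>

lemma complex_manifold_normal_space:
  assumes M: "complex_manifold M"
  shows "normal_space (mtop M)"
  using M complex_manifold_locally_compact_space[OF M]
  by (intro regular_Lindelof_imp_normal_space locally_compact_Hausdorff_imp_regular_space
      second_countable_imp_Lindelof_space) (auto simp: complex_manifold_def)


section \<open>Holomorphic maps\<close>

text \<open>Differentiability is tested only against points \<open>q\<close> of the set, so the same
  derivative \<open>a\<close> and the same \<open>d\<close> serve on a subset.\<close>

lemma holomorphic_on_space_subset:
  assumes "holomorphic_on_space n W f" "W' \<subseteq> W" "\<And>z. z \<in> W' \<Longrightarrow> f z = f' z"
  shows "holomorphic_on_space n W' f'"
  unfolding holomorphic_on_space_def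
proof
  fix p assume p: "p \<in> W'"
  then obtain a where a: "\<forall>e>0. \<exists>d>0. \<forall>q\<in>W. (\<Sum>i<n. norm (q i - p i)) < d \<longrightarrow>
        norm (f q - f p - (\<Sum>i<n. a i * (q i - p i))) \<le> e * (\<Sum>i<n. norm (q i - p i))"
    using assms(1,2) unfolding holomorphic_on_space_def by blast
  show "\<exists>a. \<forall>e>0. \<exists>d>0. \<forall>q\<in>W'. (\<Sum>i<n. norm (q i - p i)) < d \<longrightarrow>
        norm (f' q - f' p - (\<Sum>i<n. a i * (q i - p i))) \<le> e * (\<Sum>i<n. norm (q i - p i))"
  proof (intro exI[of _ a] strip)
    fix e :: real assume "e > 0"
    then obtain d where "d > 0" "\<forall>q\<in>W. (\<Sum>i<n. norm (q i - p i)) < d \<longrightarrow>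
        norm (f q - f p - (\<Sum>i<n. a i * (q i - p i))) \<le> e * (\<Sum>i<n. norm (q i - p i))"
      using a by blast
    moreover have "f p = f' p" "\<And>q. q \<in> W' \<Longrightarrow> q \<in> W \<and> f q = f' q"
      using assms(2,3) p by auto
    ultimately have "\<forall>q\<in>W'. (\<Sum>i<n. norm (q i - p i)) < d \<longrightarrow>
        norm (f' q - f' p - (\<Sum>i<n. a i * (q i - p i))) \<le> e * (\<Sum>i<n. norm (q i - p i))"
      by fastforce
    with \<open>d > 0\<close> show "\<exists>d>0. \<forall>q\<in>W'. (\<Sum>i<n. norm (q i - p i)) < d \<longrightarrow>
        norm (f' q - f' p - (\<Sum>i<n. a i * (q i - p i))) \<le> e * (\<Sum>i<n. norm (q i - p i))"
      by blast
  qed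
qed

lemma holomorphic_on_space_cong:
  assumes "W = W'" "\<And>z. z \<in> W' \<Longrightarrow> f z = f' z"
  shows "holomorphic_on_space n W f \<longleftrightarrow> holomorphic_on_space n W' f'"
  using assms holomorphic_on_space_subset[of n W f W' f'] holomorphic_on_space_subset[of n W' f' W f]
  by auto

lemma holomorphic_map_iff:
  "holomorphic_map M N f \<longleftrightarrow> continuous_map (mtop M) (mtop N) f \<and>
     (\<forall>n D \<phi>. (n, D, \<phi>) \<in> atlas M \<longrightarrow> (\<forall>m E \<psi> i. (m, E, \<psi>) \<in> atlas N \<longrightarrow> i < m \<longrightarrow>
        holomorphic_on_space n (\<phi> ` {x\<in>D. f x \<in> E}) (\<lambda>z. \<psi> (f (inv_into D \<phi> z)) i)))"
  unfolding holomorphic_map_def by (simp add: Ball_def)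

lemma holomorphic_function_iff:
  "holomorphic_function M f \<longleftrightarrow> (\<forall>n D \<phi>. (n, D, \<phi>) \<in> atlas M \<longrightarrow>
     holomorphic_on_space n (\<phi> ` D) (\<lambda>z. f (inv_into D \<phi> z)))"
  unfolding holomorphic_function_def by (simp add: Ball_def)

lemma holomorphic_function_cong:
  assumes M: "complex_manifold M" and f: "holomorphic_function M f"
    and eq: "\<And>x. x \<in> topspace (mtop M) \<Longrightarrow> f x = g x"
  shows "holomorphic_function M g"
  unfolding holomorphic_function_def
proof clarify
  fix n D \<phi> assume c: "(n, D, \<phi>) \<in> atlas M"
  then have "holomorphic_on_space n (\<phi> ` D) (\<lambda>z. f (inv_into D \<phi> z))"
    using f unfolding holomorphic_function_def by blast
  moreover have "f (inv_into D \<phi> z) = g (inv_into D \<phi> z)" if "z \<in> \<phi> ` D" for z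
    using chart_domain(2)[OF M c] inv_into_into[OF that] eq by blast
  ultimately show "holomorphic_on_space n (\<phi> ` D) (\<lambda>z. g (inv_into D \<phi> z))"
    by (rule holomorphic_on_space_subset[OF _ order_refl])
qed

text \<open>Chart domains lie in the manifold, so values elsewhere are irrelevant. This allows
  passing between a map and its extensional normalisation.\<close>

lemma holomorphic_map_cong:
  assumes M: "complex_manifold M" and f: "holomorphic_map M N f"
    and eq: "\<And>x. x \<in> topspace (mtop M) \<Longrightarrow> f x = g x"
  shows "holomorphic_map M N g"
  unfolding holomorphic_map_iff
proof (intro conjI strip)
  show "continuous_map (mtop M) (mtop N) g"
    using f eq unfolding holomorphic_map_iff by (blast intro: continuous_map_eq)
  fix n D \<phi> m E \<psi> i assume c: "(n, D, \<phi>) \<in> atlas M" "(m, E, \<psi>) \<in> atlas N" "i < (m::nat)"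
  have D: "\<And>x. x \<in> D \<Longrightarrow> f x = g x"
    using chart_domain(2)[OF M c(1)] eq by blast
  have "holomorphic_on_space n (\<phi> ` {x\<in>D. f x \<in> E}) (\<lambda>z. \<psi> (f (inv_into D \<phi> z)) i)"
    using f c unfolding holomorphic_map_iff by blast
  then show "holomorphic_on_space n (\<phi> ` {x\<in>D. g x \<in> E}) (\<lambda>z. \<psi> (g (inv_into D \<phi> z)) i)"
  proof (rule holomorphic_on_space_subset)
    show "\<psi> (f (inv_into D \<phi> z)) i = \<psi> (g (inv_into D \<phi> z)) i" if "z \<in> \<phi> ` {x\<in>D. g x \<in> E}" for z
      using D[of "inv_into D \<phi> z"] that by (simp add: image_iff) (metis image_eqI inv_into_into)
  qed (use D in auto)
qed

lemma holomorphic_map_open_submanifold_mono: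
  assumes M: "complex_manifold M" and f: "holomorphic_map (open_submanifold M R) N f"
    and "U \<subseteq> R" and eq: "\<And>x. x \<in> U \<Longrightarrow> f x = g x"
  shows "holomorphic_map (open_submanifold M U) N g"
  unfolding holomorphic_map_iff
proof (intro conjI strip)
  have "continuous_map (subtopology (mtop M) R) (mtop N) f"
    using f unfolding holomorphic_map_iff by (simp add: open_submanifold_def)
  then have "continuous_map (subtopology (mtop M) U) (mtop N) f"
    using \<open>U \<subseteq> R\<close> by (rule continuous_map_from_subtopology_mono)
  then show "continuous_map (mtop (open_submanifold M U)) (mtop N) g"
    using eq by (auto simp: open_submanifold_def intro: continuous_map_eq)
  fix n D' \<phi> m E \<psi> i
  assume "(n, D', \<phi>) \<in> atlas (open_submanifold M U)" and N: "(m, E, \<psi>) \<in> atlas N" "i < (m::nat)"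
  then obtain D where D: "(n, D, \<phi>) \<in> atlas M" "D' = D \<inter> U"
    by (auto simp: open_submanifold_def)
  then have "(n, D \<inter> R, \<phi>) \<in> atlas (open_submanifold M R)"
    by (force simp: open_submanifold_def)
  then have "holomorphic_on_space n (\<phi> ` {x\<in>D \<inter> R. f x \<in> E})
      (\<lambda>z. \<psi> (f (inv_into (D \<inter> R) \<phi> z)) i)"
    using f N unfolding holomorphic_map_iff by blast
  then show "holomorphic_on_space n (\<phi> ` {x\<in>D'. g x \<in> E}) (\<lambda>z. \<psi> (g (inv_into D' \<phi> z)) i)"
  proof (rule holomorphic_on_space_subset)
    show "\<phi> ` {x \<in> D'. g x \<in> E} \<subseteq> \<phi> ` {x \<in> D \<inter> R. f x \<in> E}"
      using D eq \<open>U \<subseteq> R\<close> by force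
    fix z assume "z \<in> \<phi> ` {x \<in> D'. g x \<in> E}"
    then obtain x where x: "x \<in> D" "x \<in> U" "z = \<phi> x"
      using D by auto
    have inj: "inj_on \<phi> D"
      using chart_domain(3)[OF M D(1)] .
    \<comment> \<open>In general \<open>inv_into\<close> depends on the set it chooses from;
      injectivity of the chart on \<open>D\<close> forces both choices to be
      \<open>x\<close>.\<close>
    have "inv_into (D \<inter> R) \<phi> z = x" "inv_into D' \<phi> z = x"
      using x D \<open>U \<subseteq> R\<close> inj by (auto intro!: inv_into_f_eq intro: inj_on_subset)
    then show "\<psi> (f (inv_into (D \<inter> R) \<phi> z)) i = \<psi> (g (inv_into D' \<phi> z)) i"
      using eq x by simp
  qed
qed

text \<open>With this, restricting a holomorphic map from all of \<open>M\<close> is an instance of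
  restricting between submanifolds.\<close>

lemma open_submanifold_topspace:
  fixes M :: "'a mfd"
  assumes M: "complex_manifold M"
  shows "open_submanifold M (topspace (mtop M)) = M"
proof -
  have "(\<lambda>(n, D, \<phi>). (n, D \<inter> topspace (mtop M), \<phi>)) ` atlas M = (\<lambda>c. c) ` atlas M"
    using chart_domain(2)[OF M] by (intro image_cong) (auto simp: Int_absorb2)
  then show ?thesis
    unfolding open_submanifold_def by simp
qed

section \<open>Transport of manifolds along injections\<close>

text \<open>The structure is pulled back along the inverse \<open>g\<close>, which turns an
  injective \<open>f\<close> into an isomorphism onto its image. It serves to move a Stein manifold
  to the point type over which \<open>weakly_oka\<close> quantifies.\<close>

definition transport_mfd :: "('a \<Rightarrow> 'b) \<Rightarrow> 'a mfd \<Rightarrow> 'b mfd" where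
  "transport_mfd f M =
     (let g = inv_into (topspace (mtop M)) f in
      \<lparr>mtop = pullback_topology (f ` topspace (mtop M)) g (mtop M),
       atlas = (\<lambda>(n, D, \<phi>). (n, f ` D, \<phi> \<circ> g)) ` atlas M\<rparr>)"

locale mfd_bijection =
  fixes M :: "'a mfd" and f :: "'a \<Rightarrow> 'b"
  assumes complex_manifold: "complex_manifold M"
    and inj: "inj_on f (topspace (mtop M))"
begin

abbreviation "M' \<equiv> transport_mfd f M"
abbreviation "g \<equiv> inv_into (topspace (mtop M)) f"

lemma gf: "x \<in> topspace (mtop M) \<Longrightarrow> g (f x) = x"
  using inj by simp

lemma homeo: "homeomorphic_maps (mtop M) (mtop M') f g"
proof -
  have "continuous_map (mtop M) (pullback_topology (f ` topspace (mtop M)) g (mtop M)) f"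
    by (rule continuous_map_pullback', rule continuous_map_eq[OF continuous_map_id]) (auto simp: gf)
  moreover have "continuous_map (pullback_topology (f ` topspace (mtop M)) g (mtop M)) (mtop M) (id \<circ> g)"
    by (rule continuous_map_pullback) simp
  ultimately show ?thesis
    unfolding homeomorphic_maps_def
    by (auto simp: transport_mfd_def Let_def topspace_pullback_topology gf o_def)
qed

lemma homeo_f: "homeomorphic_map (mtop M) (mtop M') f"
  using homeo homeomorphic_map_maps by blast

lemma homeo_g: "homeomorphic_map (mtop M') (mtop M) g"
  using homeo homeomorphic_maps_map by blast

lemma topspace_M': "topspace (mtop M') = f ` topspace (mtop M)"
  using homeo_f homeomorphic_imp_surjective_map by blast

lemma atlas_M': "c \<in> atlas M' \<longleftrightarrow> (\<exists>n D \<phi>. (n, D, \<phi>) \<in> atlas M \<and> c = (n, f ` D, \<phi> \<circ> g))"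
  by (force simp: transport_mfd_def Let_def)

lemma all_charts_M':
  "(\<forall>n D \<phi>. (n, D, \<phi>) \<in> atlas M' \<longrightarrow> Q n D \<phi>) \<longleftrightarrow>
     (\<forall>n D \<phi>. (n, D, \<phi>) \<in> atlas M \<longrightarrow> Q n (f ` D) (\<phi> \<circ> g))"
  unfolding atlas_M' by blast

lemma chart_image:
  assumes "(n, D, \<phi>) \<in> atlas M" "B \<subseteq> D"
  shows "(\<phi> \<circ> g) ` f ` B = \<phi> ` B"
proof -
  have "g ` f ` B = B"
    using chart_domain(2)[OF complex_manifold assms(1)] assms(2) gf by force
  then show ?thesis
    by (metis image_comp)
qed

lemma chart_inverse:
  assumes c: "(n, D, \<phi>) \<in> atlas M" and z: "z \<in> \<phi> ` D"
  shows "inv_into (f ` D) (\<phi> \<circ> g) z = f (inv_into D \<phi> z)"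
proof (rule inv_into_f_eq)
  have D: "D \<subseteq> topspace (mtop M)" and "inj_on \<phi> D"
    using chart_domain[OF complex_manifold c] by auto
  then show "inj_on (\<phi> \<circ> g) (f ` D)"
    by (auto simp: inj_on_def gf subset_iff)
  show "f (inv_into D \<phi> z) \<in> f ` D"
    using z by (simp add: inv_into_into)
  have "inv_into D \<phi> z \<in> topspace (mtop M)"
    using D inv_into_into[OF z] by blast
  then show "(\<phi> \<circ> g) (f (inv_into D \<phi> z)) = z"
    using z by (simp add: gf f_inv_into_f)
qed

text \<open>Transport renames points but keeps coordinates: both conditions concern the same
  function on the same subset of the model space. The free \<open>u\<close> lets this cover
  transition maps, functions and maps alike.\<close>

lemma holomorphic_on_chart_transport:
  assumes c: "(n, D, \<phi>) \<in> atlas M" and B: "B \<subseteq> D"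
  shows "holomorphic_on_space n ((\<phi> \<circ> g) ` f ` B) (\<lambda>z. u (inv_into (f ` D) (\<phi> \<circ> g) z))
     \<longleftrightarrow> holomorphic_on_space n (\<phi> ` B) (\<lambda>z. u (f (inv_into D \<phi> z)))"
proof (rule holomorphic_on_space_cong)
  show "u (inv_into (f ` D) (\<phi> \<circ> g) z) = u (f (inv_into D \<phi> z))" if "z \<in> \<phi> ` B" for z
    using chart_inverse[OF c, of z] B that by (simp add: image_iff subset_iff) metis
qed (rule chart_image[OF c B])

lemma complex_manifold_M': "complex_manifold M'"
  unfolding complex_manifold_def
proof (intro conjI ballI)
  have sp: "mtop M homeomorphic_space mtop M'"
    using homeo_f by (rule homeomorphic_map_imp_homeomorphic_space)
  show "Hausdorff_space (mtop M')" "second_countable (mtop M')"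
    using homeomorphic_Hausdorff_space[OF sp] homeomorphic_space_second_countability[OF sp]
      complex_manifold by (simp_all add: complex_manifold_def)
  show "is_chart (mtop M') c" if "c \<in> atlas M'" for c
  proof -
    obtain n D \<phi> where c: "(n, D, \<phi>) \<in> atlas M" "c = (n, f ` D, \<phi> \<circ> g)"
      using \<open>c \<in> atlas M'\<close> atlas_M' by blast
    note ch = chart_domain[OF complex_manifold c(1)]
    have im: "(\<phi> \<circ> g) ` f ` D = \<phi> ` D"
      using chart_image[OF c(1)] by blast
    have "openin (mtop M') (f ` D)"
      using homeomorphic_map_openness[OF homeo_f ch(2)] ch(1) by blast
    moreover have "g ` (topspace (mtop M') \<inter> f ` D) = topspace (mtop M) \<inter> D"
      using ch(2) gf unfolding topspace_M' by force
    then have "homeomorphic_map (subtopology (mtop M') (f ` D)) (subtopology (mtop M) D) g"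
      by (rule homeomorphic_map_subtopologies[OF homeo_g])
    then have "homeomorphic_map (subtopology (mtop M') (f ` D))
        (subtopology (complex_space n) (\<phi> ` D)) (\<phi> \<circ> g)"
      using ch(5) by (rule homeomorphic_map_compose)
    ultimately show ?thesis
      unfolding is_chart_def c(2) using im ch(4) by simp
  qed
  show "(\<Union>(n, D, \<phi>)\<in>atlas M'. D) = topspace (mtop M')"
  proof -
    have "(\<Union>(n, D, \<phi>)\<in>atlas M'. D) = f ` (\<Union>(n, D, \<phi>)\<in>atlas M. D)"
      by (auto simp: transport_mfd_def Let_def case_prod_unfold)
    then show ?thesis
      using complex_manifold unfolding topspace_M' complex_manifold_def by simp
  qed
  show "holomorphic_transition c c'" if "c \<in> atlas M'" "c' \<in> atlas M'" for c c'
  proof -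
    obtain n D \<phi> where c: "(n, D, \<phi>) \<in> atlas M" "c = (n, f ` D, \<phi> \<circ> g)"
      using \<open>c \<in> atlas M'\<close> atlas_M' by blast
    obtain m E \<psi> where c': "(m, E, \<psi>) \<in> atlas M" "c' = (m, f ` E, \<psi> \<circ> g)"
      using \<open>c' \<in> atlas M'\<close> atlas_M' by blast
    have DE: "D \<subseteq> topspace (mtop M)" "E \<subseteq> topspace (mtop M)"
      using chart_domain(2)[OF complex_manifold] c(1) c'(1) by blast+
    then have int: "f ` D \<inter> f ` E = f ` (D \<inter> E)"
      using inj_on_image_Int[OF inj] by simp
    have "holomorphic_on_space n (\<phi> ` (D \<inter> E)) (\<lambda>z. \<psi> (inv_into D \<phi> z) i)" if "i < m" for i
      using complex_manifold c(1) c'(1) that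
      unfolding complex_manifold_def holomorphic_transition_def by fast
    moreover have "holomorphic_on_space n (\<phi> ` (D \<inter> E)) (\<lambda>z. \<psi> (inv_into D \<phi> z) i)
      \<longleftrightarrow> holomorphic_on_space n (\<phi> ` (D \<inter> E)) (\<lambda>z. (\<psi> \<circ> g) (f (inv_into D \<phi> z)) i)" for i
      using DE(1) by (intro holomorphic_on_space_cong) (auto simp: gf subset_iff inv_into_into)
    ultimately have "\<forall>i<m. holomorphic_on_space n ((\<phi> \<circ> g) ` (f ` D \<inter> f ` E))
        (\<lambda>z. (\<psi> \<circ> g) (inv_into (f ` D) (\<phi> \<circ> g) z) i)"
      unfolding int
      using holomorphic_on_chart_transport[OF c(1) Int_lower1[of D E], of "\<lambda>x. (\<psi> \<circ> g) x _"] by blast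
    then show ?thesis
      unfolding holomorphic_transition_def c(2) c'(2) prod.case .
  qed
qed

lemma holomorphic_function_M':
  "holomorphic_function M' u \<longleftrightarrow> holomorphic_function M (u \<circ> f)"
proof -
  have "holomorphic_on_space n ((\<phi> \<circ> g) ` f ` D) (\<lambda>z. u (inv_into (f ` D) (\<phi> \<circ> g) z))
      \<longleftrightarrow> holomorphic_on_space n (\<phi> ` D) (\<lambda>z. (u \<circ> f) (inv_into D \<phi> z))"
    if "(n, D, \<phi>) \<in> atlas M" for n D \<phi>
    using holomorphic_on_chart_transport[OF that order_refl, of u] by (simp only: o_apply)
  then show ?thesis
    unfolding holomorphic_function_iff all_charts_M' by (intro all_cong1 imp_cong refl)
qed

lemma continuous_map_M':
  "continuous_map (mtop M') Y u \<longleftrightarrow> continuous_map (mtop M) Y (u \<circ> f)"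
proof
  assume "continuous_map (mtop M') Y u"
  with homeomorphic_imp_continuous_map[OF homeo_f] show "continuous_map (mtop M) Y (u \<circ> f)"
    by (rule continuous_map_compose)
next
  assume "continuous_map (mtop M) Y (u \<circ> f)"
  with homeomorphic_imp_continuous_map[OF homeo_g] have "continuous_map (mtop M') Y (u \<circ> f \<circ> g)"
    by (rule continuous_map_compose)
  then show "continuous_map (mtop M') Y u"
    by (rule continuous_map_eq) (auto simp: topspace_M' gf)
qed

lemma holomorphic_map_M':
  "holomorphic_map M' N u \<longleftrightarrow> holomorphic_map M N (u \<circ> f)"
proof -
  have eq: "holomorphic_on_space n ((\<phi> \<circ> g) ` {y \<in> f ` D. u y \<in> E})
        (\<lambda>z. \<psi> (u (inv_into (f ` D) (\<phi> \<circ> g) z)) i)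
      \<longleftrightarrow> holomorphic_on_space n (\<phi> ` {x \<in> D. (u \<circ> f) x \<in> E}) (\<lambda>z. \<psi> ((u \<circ> f) (inv_into D \<phi> z)) i)"
    if "(n, D, \<phi>) \<in> atlas M" for n D \<phi> E and \<psi> :: "_ \<Rightarrow> nat \<Rightarrow> complex" and i
  proof -
    have "{y \<in> f ` D. u y \<in> E} = f ` {x \<in> D. (u \<circ> f) x \<in> E}"
      by auto
    then show ?thesis
      using holomorphic_on_chart_transport[OF that, of "{x \<in> D. (u \<circ> f) x \<in> E}" "\<lambda>y. \<psi> (u y) i"]
      by simp
  qed
  show ?thesis
    unfolding holomorphic_map_iff continuous_map_M' all_charts_M'
    by (intro conj_cong all_cong1 imp_cong refl) (erule eq)
qed

lemma stein_manifold_M':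
  assumes stein: "stein_manifold M"
  shows "stein_manifold M'"
  unfolding stein_manifold_def
proof (intro conjI allI impI ballI)
  show "complex_manifold M'"
    by (rule complex_manifold_M')
  have lift: "holomorphic_function M' (v \<circ> g)" if "holomorphic_function M v" for v
    unfolding holomorphic_function_M'
    by (rule holomorphic_function_cong[OF complex_manifold that]) (simp add: gf)
  show "compactin (mtop M') (holomorphic_hull M' K)" if K: "compactin (mtop M') K" for K
  proof -
    have fg: "f (g k) = k" if "k \<in> K" for k
      using compactin_subset_topspace[OF K] that by (auto simp: topspace_M' gf)
    \<comment> \<open>Composition with \<open>f\<close> and with \<open>g\<close> carries
      holomorphic functions of either manifold to those of the other, so the inequalities defining
      the two hulls correspond.\<close>
    have "holomorphic_hull M' K = f ` holomorphic_hull M (g ` K)"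
    proof (intro equalityI subsetI)
      fix y assume y: "y \<in> holomorphic_hull M' K"
      then obtain x where x: "x \<in> topspace (mtop M)" "y = f x"
        by (auto simp: holomorphic_hull_def topspace_M')
      have "\<exists>k\<in>K. norm (v x) \<le> norm (v (g k))" if "holomorphic_function M v" for v
        using y lift[OF that] x by (force simp: holomorphic_hull_def gf)
      then show "y \<in> f ` holomorphic_hull M (g ` K)"
        using x by (auto simp: holomorphic_hull_def)
    next
      fix y assume "y \<in> f ` holomorphic_hull M (g ` K)"
      then obtain x where x: "x \<in> holomorphic_hull M (g ` K)" "y = f x"
        by blast
      have "\<exists>k\<in>K. norm (u y) \<le> norm (u k)" if "holomorphic_function M' u" for u
      proof -
        have "\<exists>k\<in>g ` K. norm ((u \<circ> f) x) \<le> norm ((u \<circ> f) k)"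
          using x(1) that unfolding holomorphic_function_M' holomorphic_hull_def by blast
        then show ?thesis
          using x(2) fg by auto
      qed
      then show "y \<in> holomorphic_hull M' K"
        using x by (auto simp: holomorphic_hull_def topspace_M')
    qed
    moreover have "compactin (mtop M) (g ` K)"
      using K homeomorphic_imp_continuous_map[OF homeo_g] by (rule image_compactin)
    then have "compactin (mtop M) (holomorphic_hull M (g ` K))"
      using stein by (simp add: stein_manifold_def)
    then have "compactin (mtop M') (f ` holomorphic_hull M (g ` K))"
      using homeomorphic_imp_continuous_map[OF homeo_f] by (rule image_compactin)
    ultimately show ?thesis
      by simp
  qed
  show "\<exists>u. holomorphic_function M' u \<and> u x \<noteq> u y"
    if xy: "x \<in> topspace (mtop M')" "y \<in> topspace (mtop M')" "x \<noteq> y" for x y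
  proof -
    obtain a b where ab: "a \<in> topspace (mtop M)" "b \<in> topspace (mtop M)" "x = f a" "y = f b"
      using xy by (auto simp: topspace_M')
    then obtain v where "holomorphic_function M v" "v a \<noteq> v b"
      using stein xy(3) unfolding stein_manifold_def by metis
    then show ?thesis
      using lift ab by (intro exI[of _ "v \<circ> g"]) (simp add: gf)
  qed
qed

end

lemma stein_manifold_transport_nat_set:
  fixes M :: "'a mfd"
  assumes "stein_manifold M"
  obtains f :: "'a \<Rightarrow> nat set" where "mfd_bijection M f"
proof -
  have M: "complex_manifold M"
    using assms by (simp add: stein_manifold_def)
  then obtain f :: "'a \<Rightarrow> nat set" where "inj_on f (topspace (mtop M))"
    using complex_manifold_inj_into_nat_set by blast
  with M show thesis
    by (intro that mfd_bijection.intro)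
qed

section \<open>Weakly Oka manifolds\<close>

lemma weakly_oka_homotopic_to_holomorphic_nat_set:
  fixes T :: "nat set mfd"
  assumes X: "weakly_oka X" and T: "stein_manifold T" and h: "continuous_map (mtop T) (mtop X) h"
  obtains H where "continuous_map (prod_topology (mtop T) I01) (mtop X) H"
    "\<And>x. x \<in> topspace (mtop T) \<Longrightarrow> H (x, 0) = h x" "holomorphic_map T X (\<lambda>x. H (x, 1))"
proof -
  let ?C = "compact_open_topology (mtop T) (mtop X)"
  have M: "complex_manifold T"
    using T by (simp add: stein_manifold_def)
  have whe: "weak_homotopy_equivalence (subtopology ?C {f. holomorphic_map T X f}) ?C (\<lambda>f. f)"
    using X T unfolding weakly_oka_def holomorphic_mapping_space_def by blast
  have "restrict h (topspace (mtop T)) \<in> topspace ?C"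
    using h by (auto simp: continuous_maps_def intro: continuous_map_eq)
  then obtain a where "holomorphic_map T X a" "path_component_of ?C (restrict h (topspace (mtop T))) a"
    using weak_homotopy_equivalence_inclusion_path_into[OF whe] by blast
  then obtain g where g: "continuous_map I01 ?C g" "g 0 = restrict h (topspace (mtop T))"
      "holomorphic_map T X (g 1)"
    unfolding path_component_of_def pathin_def by blast
  show thesis
  proof (rule that)
    show "continuous_map (prod_topology (mtop T) I01) (mtop X) (\<lambda>(x, t). g t x)"
      using M complex_manifold_locally_compact_space[OF M] g(1)
      by (intro continuous_map_uncurry_compact_open) (auto simp: complex_manifold_def)
  qed (use g in auto)
qed

text \<open>Currying makes \<open>P\<close> a path of continuous maps with holomorphic ends; this
  path is deformed into the holomorphic maps and the result is uncurried. In
  \<open>G (x, t, s)\<close> the path parameter is \<open>t\<close> and the deformation parameter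
  \<open>s\<close>.\<close>

lemma weakly_oka_deform_homotopy_nat_set:
  fixes T :: "nat set mfd"
  assumes X: "weakly_oka X" and T: "stein_manifold T"
    and P: "continuous_map (prod_topology (mtop T) I01) (mtop X) P"
    and P01: "holomorphic_map T X (\<lambda>x. P (x, 0))" "holomorphic_map T X (\<lambda>x. P (x, 1))"
  obtains G where "continuous_map (prod_topology (mtop T) (prod_topology I01 I01)) (mtop X) G"
    "\<And>x t. x \<in> topspace (mtop T) \<Longrightarrow> t \<in> {0..1} \<Longrightarrow> G (x, t, 0) = P (x, t)"
    "\<And>x s. x \<in> topspace (mtop T) \<Longrightarrow> s \<in> {0..1} \<Longrightarrow> G (x, 0, s) = P (x, 0)"
    "\<And>x s. x \<in> topspace (mtop T) \<Longrightarrow> s \<in> {0..1} \<Longrightarrow> G (x, 1, s) = P (x, 1)"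
    "\<And>t. t \<in> {0..1} \<Longrightarrow> holomorphic_map T X (\<lambda>x. G (x, t, 1))"
proof -
  let ?C = "compact_open_topology (mtop T) (mtop X)"
  have M: "complex_manifold T"
    using T by (simp add: stein_manifold_def)
  have whe: "weak_homotopy_equivalence (subtopology ?C {f. holomorphic_map T X f}) ?C (\<lambda>f. f)"
    using X T unfolding weakly_oka_def holomorphic_mapping_space_def by blast
  define p where "p = (\<lambda>t. \<lambda>x\<in>topspace (mtop T). P (x, t))"
  have "pathin ?C p"
    unfolding pathin_def p_def using P by (rule continuous_map_curry_compact_open)
  moreover have "holomorphic_map T X (p 0)" "holomorphic_map T X (p 1)"
    by (rule holomorphic_map_cong[OF M P01(1)], simp add: p_def)
       (rule holomorphic_map_cong[OF M P01(2)], simp add: p_def)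
  ultimately obtain g where g: "continuous_map (prod_topology I01 I01) ?C g"
    "\<And>t. t \<in> {0..1} \<Longrightarrow> g (t, 0) = p t" "\<And>t. t \<in> {0..1} \<Longrightarrow> holomorphic_map T X (g (t, 1))"
    "\<And>s. s \<in> {0..1} \<Longrightarrow> g (0, s) = p 0" "\<And>s. s \<in> {0..1} \<Longrightarrow> g (1, s) = p 1"
    using weak_homotopy_equivalence_inclusion_deform_path[OF whe] unfolding mem_Collect_eq by metis
  show thesis
  proof (rule that)
    show "continuous_map (prod_topology (mtop T) (prod_topology I01 I01)) (mtop X) (\<lambda>(x, u). g u x)"
      using M complex_manifold_locally_compact_space[OF M] g(1)
      by (intro continuous_map_uncurry_compact_open) (auto simp: complex_manifold_def)
  qed (use g in \<open>auto simp: p_def\<close>)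
qed

text \<open>The homotopy is found on the copy of \<open>T\<close> with points in
  \<open>nat set\<close> and pulled back along \<open>f\<close>.\<close>

lemma weakly_oka_homotopic_to_holomorphic:
  assumes X: "weakly_oka X" and T: "stein_manifold T" and h: "continuous_map (mtop T) (mtop X) h"
  obtains H where "continuous_map (prod_topology (mtop T) I01) (mtop X) H"
    "\<And>x. x \<in> topspace (mtop T) \<Longrightarrow> H (x, 0) = h x" "holomorphic_map T X (\<lambda>x. H (x, 1))"
proof -
  obtain f :: "'b \<Rightarrow> nat set" where "mfd_bijection T f"
    using stein_manifold_transport_nat_set[OF T] .
  then interpret mfd_bijection T f .
  have "continuous_map (mtop M') (mtop X) (h \<circ> g)"
    using homeomorphic_imp_continuous_map[OF homeo_g] h by (rule continuous_map_compose)
  then obtain H where H: "continuous_map (prod_topology (mtop M') I01) (mtop X) H"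
    "\<And>y. y \<in> topspace (mtop M') \<Longrightarrow> H (y, 0) = (h \<circ> g) y" "holomorphic_map M' X (\<lambda>y. H (y, 1))"
    using weakly_oka_homotopic_to_holomorphic_nat_set[OF X stein_manifold_M'[OF T]] by metis
  show thesis
  proof (rule that)
    have "continuous_map (prod_topology (mtop T) I01) (prod_topology (mtop M') I01) (\<lambda>(x, t). (f x, t))"
      using homeomorphic_imp_continuous_map[OF homeo_f] unfolding continuous_map_prod_top by simp
    from continuous_map_compose[OF this H(1)]
    show "continuous_map (prod_topology (mtop T) I01) (mtop X) (\<lambda>(x, t). H (f x, t))"
      by (simp add: o_def case_prod_unfold)
    show "(\<lambda>(x, t). H (f x, t)) (x, 0) = h x" if "x \<in> topspace (mtop T)" for x
      using H(2)[of "f x"] that by (simp add: topspace_M' gf)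
    show "holomorphic_map T X (\<lambda>x. (\<lambda>(x, t). H (f x, t)) (x, 1))"
      using H(3) unfolding holomorphic_map_M' by (simp add: o_def)
  qed
qed

lemma weakly_oka_deform_homotopy:
  assumes X: "weakly_oka X" and T: "stein_manifold T"
    and P: "continuous_map (prod_topology (mtop T) I01) (mtop X) P"
    and P01: "holomorphic_map T X (\<lambda>x. P (x, 0))" "holomorphic_map T X (\<lambda>x. P (x, 1))"
  obtains G where "continuous_map (prod_topology (mtop T) (prod_topology I01 I01)) (mtop X) G"
    "\<And>x t. x \<in> topspace (mtop T) \<Longrightarrow> t \<in> {0..1} \<Longrightarrow> G (x, t, 0) = P (x, t)"
    "\<And>x s. x \<in> topspace (mtop T) \<Longrightarrow> s \<in> {0..1} \<Longrightarrow> G (x, 0, s) = P (x, 0)"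
    "\<And>x s. x \<in> topspace (mtop T) \<Longrightarrow> s \<in> {0..1} \<Longrightarrow> G (x, 1, s) = P (x, 1)"
    "\<And>t. t \<in> {0..1} \<Longrightarrow> holomorphic_map T X (\<lambda>x. G (x, t, 1))"
proof -
  obtain f :: "'b \<Rightarrow> nat set" where "mfd_bijection T f"
    using stein_manifold_transport_nat_set[OF T] .
  then interpret mfd_bijection T f .
  define P' where "P' = (\<lambda>(y, t). P (g y, t))"
  have "continuous_map (prod_topology (mtop M') I01) (prod_topology (mtop T) I01) (\<lambda>(y, t). (g y, t))"
    using homeomorphic_imp_continuous_map[OF homeo_g] unfolding continuous_map_prod_top by simp
  from continuous_map_compose[OF this P]
  have P': "continuous_map (prod_topology (mtop M') I01) (mtop X) P'"
    by (simp add: P'_def o_def case_prod_unfold)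
  have P'0: "holomorphic_map M' X (\<lambda>y. P' (y, 0))"
    unfolding holomorphic_map_M'
    by (rule holomorphic_map_cong[OF complex_manifold P01(1)]) (simp add: P'_def gf)
  have P'1: "holomorphic_map M' X (\<lambda>y. P' (y, 1))"
    unfolding holomorphic_map_M'
    by (rule holomorphic_map_cong[OF complex_manifold P01(2)]) (simp add: P'_def gf)
  obtain G where G: "continuous_map (prod_topology (mtop M') (prod_topology I01 I01)) (mtop X) G"
    "\<And>y t. y \<in> topspace (mtop M') \<Longrightarrow> t \<in> {0..1} \<Longrightarrow> G (y, t, 0) = P' (y, t)"
    "\<And>y s. y \<in> topspace (mtop M') \<Longrightarrow> s \<in> {0..1} \<Longrightarrow> G (y, 0, s) = P' (y, 0)"
    "\<And>y s. y \<in> topspace (mtop M') \<Longrightarrow> s \<in> {0..1} \<Longrightarrow> G (y, 1, s) = P' (y, 1)"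
    "\<And>t. t \<in> {0..1} \<Longrightarrow> holomorphic_map M' X (\<lambda>y. G (y, t, 1))"
    using weakly_oka_deform_homotopy_nat_set[OF X stein_manifold_M'[OF T] P' P'0 P'1] by metis
  show thesis
  proof (rule that)
    have "continuous_map (prod_topology (mtop T) (prod_topology I01 I01))
        (prod_topology (mtop M') (prod_topology I01 I01)) (\<lambda>(x, u). (f x, u))"
      using homeomorphic_imp_continuous_map[OF homeo_f] unfolding continuous_map_prod_top by simp
    from continuous_map_compose[OF this G(1)]
    show "continuous_map (prod_topology (mtop T) (prod_topology I01 I01)) (mtop X) (\<lambda>(x, u). G (f x, u))"
      by (simp add: o_def case_prod_unfold)
    show "holomorphic_map T X (\<lambda>x. (\<lambda>(x, u). G (f x, u)) (x, t, 1))" if "t \<in> {0..1}" for t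
      using G(5)[OF that] unfolding holomorphic_map_M' by (simp add: o_def)
  qed (use G in \<open>auto simp: topspace_M' gf P'_def\<close>)
qed

section \<open>Gluing the deformation over \<open>R\<close> to the homotopy on
  \<open>S\<close>\<close>

theorem mainTheorem7:
  fixes X :: "'a mfd" and S :: "'b mfd" and R U V :: "'b set" and h :: "'b \<Rightarrow> 'a"
  assumes "weakly_oka X"
    and "stein_manifold S"
    and "openin (mtop S) R"
    and "stein_manifold (open_submanifold S R)"
    and "openin (subtopology (mtop S) R) U"
    and "openin (subtopology (mtop S) R) V"
    and "mtop S closure_of U \<subseteq> V"
    and "mtop S closure_of V \<subseteq> R"
    and "continuous_map (mtop S) (mtop X) h"
    and "holomorphic_map (open_submanifold S R) X h"
  shows "\<exists>H :: 'b \<times> real \<Rightarrow> 'a.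
    continuous_map (prod_topology (mtop S) (top_of_set {0..1})) (mtop X) H \<and>
    (\<forall>x\<in>topspace (mtop S). H (x, 0) = h x) \<and>
    (\<forall>t\<in>{0..1}. holomorphic_map (open_submanifold S U) X (\<lambda>x. H (x, t))) \<and>
    holomorphic_map S X (\<lambda>x. H (x, 1))"
proof -
  have S: "complex_manifold S" and SR: "complex_manifold (open_submanifold S R)"
    using assms(2,4) by (simp_all add: stein_manifold_def)
  have R: "R \<subseteq> topspace (mtop S)"
    using assms(3) by (rule openin_subset)
  have topR: "mtop (open_submanifold S R) = subtopology (mtop S) R"
    "topspace (mtop (open_submanifold S R)) = R"
    using R by (auto simp: open_submanifold_def)
  have UR: "U \<subseteq> R" and VR: "V \<subseteq> R"
    using assms(5,6) openin_subset by fastforce+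
  have V: "openin (mtop S) V"
    using assms(3,6) by (meson openin_trans_full)

  obtain P where P: "continuous_map (prod_topology (mtop S) I01) (mtop X) P"
    "\<And>x. x \<in> topspace (mtop S) \<Longrightarrow> P (x, 0) = h x" "holomorphic_map S X (\<lambda>x. P (x, 1))"
    using weakly_oka_homotopic_to_holomorphic[OF assms(1,2,9)] by metis
  have PR: "continuous_map (prod_topology (mtop (open_submanifold S R)) I01) (mtop X) P"
    unfolding topR prod_topology_subtopology(1)[of "mtop S" R] using P(1) by (rule continuous_map_from_subtopology)
  \<comment> \<open>The two ends are holomorphic on \<open>R\<close> for different reasons: the
    initial one is \<open>h\<close>, the final one restricts a map holomorphic on
    \<open>S\<close>.\<close>
  have PR0: "holomorphic_map (open_submanifold S R) X (\<lambda>x. P (x, 0))"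
    using P(2) R topR by (intro holomorphic_map_cong[OF SR assms(10)]) (simp add: subset_iff)
  have PR1: "holomorphic_map (open_submanifold S R) X (\<lambda>x. P (x, 1))"
    using holomorphic_map_open_submanifold_mono[OF S, of "topspace (mtop S)" X "\<lambda>x. P (x, 1)" R "\<lambda>x. P (x, 1)"]
      P(3) R by (simp add: open_submanifold_topspace[OF S])
  obtain G where G: "continuous_map (prod_topology (mtop (open_submanifold S R)) (prod_topology I01 I01)) (mtop X) G"
    "\<And>x t. x \<in> topspace (mtop (open_submanifold S R)) \<Longrightarrow> t \<in> {0..1} \<Longrightarrow> G (x, t, 0) = P (x, t)"
    "\<And>x s. x \<in> topspace (mtop (open_submanifold S R)) \<Longrightarrow> s \<in> {0..1} \<Longrightarrow> G (x, 0, s) = P (x, 0)"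
    "\<And>x s. x \<in> topspace (mtop (open_submanifold S R)) \<Longrightarrow> s \<in> {0..1} \<Longrightarrow> G (x, 1, s) = P (x, 1)"
    "\<And>t. t \<in> {0..1} \<Longrightarrow> holomorphic_map (open_submanifold S R) X (\<lambda>x. G (x, t, 1))"
    using weakly_oka_deform_homotopy[OF assms(1,4) PR PR0 PR1] by metis
  note GR = G(2-4)[unfolded topR(2)]

  have "closedin (mtop S) (topspace (mtop S) - V)"
    using V by blast
  moreover have "disjnt (topspace (mtop S) - V) (mtop S closure_of U)"
    using assms(7) by (auto simp: disjnt_def)
  ultimately obtain \<rho> where \<rho>: "continuous_map (mtop S) I01 \<rho>"
      and \<rho>V: "\<rho> ` (topspace (mtop S) - V) \<subseteq> {0}" and \<rho>U: "\<rho> ` (mtop S closure_of U) \<subseteq> {1}"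
    by (rule Urysohn_lemma[OF complex_manifold_normal_space[OF S] _ closedin_closure_of _ zero_le_one])
  have \<rho>0: "\<rho> x = 0" if "x \<in> topspace (mtop S)" "x \<notin> V" for x
    using that \<rho>V by blast
  have "U \<subseteq> mtop S closure_of U"
    using UR R by (intro closure_of_subset) auto
  then have \<rho>1: "\<rho> x = 1" if "x \<in> U" for x
    using that \<rho>U by blast
  have \<rho>01: "\<rho> x \<in> {0..1}" if "x \<in> topspace (mtop S)" for x
    using continuous_map_image_subset_topspace[OF \<rho>] that by auto

  define H where "H = (\<lambda>(x, t). if x \<in> R then G (x, t, \<rho> x) else P (x, t))"
  show ?thesis
  proof (intro exI[of _ H] conjI ballI)
    \<comment> \<open>Pasting needs an open cover, so the closure of \<open>V\<close> is removed
      instead of \<open>V\<close>. The two pieces still cover because this closure lies in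
      \<open>R\<close>.\<close>
    define W where "W b = (if b then R else topspace (mtop S) - mtop S closure_of V) \<times> {0..1::real}" for b
    show "continuous_map (prod_topology (mtop S) I01) (mtop X) H"
    proof (rule pasting_lemma[where I = UNIV and T = W and f = "\<lambda>b. if b then (\<lambda>(x, t). G (x, t, \<rho> x)) else P"])
      show "openin (prod_topology (mtop S) I01) (W b)" for b
        using assms(3) by (auto simp: W_def openin_prod_Times_iff)
      show "continuous_map (subtopology (prod_topology (mtop S) I01) (W b)) (mtop X)
          (if b then \<lambda>(x, t). G (x, t, \<rho> x) else P)" for b
      proof (cases b)
        case True
        have top: "subtopology (prod_topology (mtop S) I01) (W True)
            = prod_topology (subtopology (mtop S) R) I01"
          unfolding W_def prod_topology_subtopology(1)[of "mtop S" R] by simp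
        have "continuous_map (prod_topology (subtopology (mtop S) R) I01)
            (prod_topology (subtopology (mtop S) R) (prod_topology I01 I01)) (\<lambda>u. (fst u, snd u, \<rho> (fst u)))"
          unfolding continuous_map_pairwise o_def fst_conv snd_conv
          using continuous_map_compose[OF continuous_map_fst continuous_map_from_subtopology[OF \<rho>]]
          by (intro conjI continuous_map_fst continuous_map_snd) (simp add: o_def)
        from continuous_map_compose[OF this G(1)[unfolded topR(1)]]
        show ?thesis
          using True top by (simp add: o_def case_prod_unfold)
      next
        case False
        then show ?thesis
          using continuous_map_from_subtopology[OF P(1)] by simp
      qed
      have VV: "V \<subseteq> mtop S closure_of V"
        using openin_subset[OF V] by (rule closure_of_subset)
      \<comment> \<open>Off the closure of \<open>V\<close> the parameter \<open>\<rho> x\<close> is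
        0, where the deformation has not yet started.\<close>
      have overlap: "G (x, t, \<rho> x) = P (x, t)"
        if "x \<in> R" "x \<notin> mtop S closure_of V" "t \<in> {0..1}" for x t
      proof -
        have "\<rho> x = 0"
          using \<rho>0[of x] that R VV by blast
        then show ?thesis
          using GR(1)[of x t] that by simp
      qed
      show "(if b then \<lambda>(x, t). G (x, t, \<rho> x) else P) u = (if b' then \<lambda>(x, t). G (x, t, \<rho> x) else P) u"
        if "u \<in> topspace (prod_topology (mtop S) I01) \<inter> W b \<inter> W b'" for b b' u
        using that overlap by (cases u) (auto simp: W_def split: if_splits)
      show "\<exists>b. b \<in> UNIV \<and> u \<in> W b \<and> H u = (if b then \<lambda>(x, t). G (x, t, \<rho> x) else P) u"
        if "u \<in> topspace (prod_topology (mtop S) I01)" for u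
        using that assms(8) by (intro exI[of _ "fst u \<in> R"]) (auto simp: W_def H_def)
    qed
    show "H (x, 0) = h x" if "x \<in> topspace (mtop S)" for x
      using GR(2)[of x "\<rho> x"] P(2)[OF that] \<rho>01[OF that] by (simp add: H_def)
    \<comment> \<open>On \<open>U\<close> the parameter is constantly 1, so \<open>H\<close> is
      there the fully deformed, holomorphic slice of \<open>G\<close>.\<close>
    show "holomorphic_map (open_submanifold S U) X (\<lambda>x. H (x, t))" if "t \<in> {0..1}" for t
      using UR \<rho>1 by (intro holomorphic_map_open_submanifold_mono[OF S G(5)[OF that] UR]) (auto simp: H_def)
    \<comment> \<open>Since the deformation fixes the end of the path, \<open>H\<close> equals
      \<open>P\<close> at time 1 on all of \<open>S\<close>, even where \<open>\<rho>\<close>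
      varies.\<close>
    show "holomorphic_map S X (\<lambda>x. H (x, 1))"
      using GR(3) \<rho>01 by (intro holomorphic_map_cong[OF S P(3)]) (simp add: H_def)
  qed
qed

end
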